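(* Let $\mathcal{T}$ be a finite collection of distinct prototiles in $\mathbb{R}^d$ and let $X_{\mathcal{T}}$ be the associated full tiling space, endowed with the metric $d_1$. The action by translation is continuous, that is, the map $T\colon\mathbb{R}^d\times X_{\mathcal{T}}\to X_{\mathcal{T}}$ given by $T(v,x):=T_v x$ is continuous.
   Context: Fix $d\ge 1$ and a norm $\|\cdot\|$ on $\mathbb{R}^d$. For $r>0$, $B_r$ is the closed ball of radius $r$ centered at the origin. A tile is a nonempty compact connected subset of $\mathbb{R}^d$ that equals the closure of its interior. A tiling is a collection of tiles with pairwise disjoint interiors whose union is $\mathbb{R}^d$. Two tiles are equivalent if one is a translate of the other; the equivalence classes are called prototiles. For a finite collection $\mathcal{T}$ of prototiles, the full tiling space $X_{\mathcal{T}}$ is the set of all tilings of $\mathbb{R}^d$ each of whose tiles belongs to some prototile in $\mathcal{T}$. A patch is a nonempty finite subset $y$ of some tiling $x\in X_{\mathcal{T}}$ such that the union of the tiles in $y$, called its support $\operatorname{supp}(y)$, is connected. For a set $x$ of tiles and $v\in\mathbb{R}^d$, $T_v x:=\{D-v : D\in x\}$. For $x\in X_{\mathcal{T}}$ and a compact connected set $K\subset\mathbb{R}^d$, $x[[K]]$ denotes the set of patches $x'\subset x$ with $K\subset\operatorname{supp}(x')$. The tiling metric is $d_1(x,y)=\min\left(\frac{1}{\sqrt2},\tilde d_1(x,y)\right)$, where $$\tilde d_1(x,y)=\inf\left\{0<r<\tfrac{1}{\sqrt2} : \exists x'\in x[[B_{1/r}]],\ \exists y'\in y[[B_{1/r}]],\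 \exists v\in B_r,\ T_v x'=y'\right\}$$ (with $\inf\emptyset=+\infty$). $\mathbb{R}^d$ has its usual topology and $\mathbb{R}^d\times X_{\mathcal{T}}$ the product topology. *)

theory Defs
  imports "HOL-Analysis.Analysis"
begin

definition is_norm :: "(real ^ 'n \<Rightarrow> real) \<Rightarrow> bool" where
  "is_norm N \<longleftrightarrow>
     (\<forall>p. 0 \<le> N p) \<and>
     (\<forall>p. N p = 0 \<longleftrightarrow> p = 0) \<and>
     (\<forall>c p. N (c *\<^sub>R p) = \<bar>c\<bar> * N p) \<and>
     (\<forall>p q. N (p + q) \<le> N p + N q)"

definition norm_ball :: "(real ^ 'n \<Rightarrow> real) \<Rightarrow> real \<Rightarrow> (real ^ 'n) set" where
  "norm_ball N r = {p. N p \<le> r}"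

definition tile :: "(real ^ 'n) set \<Rightarrow> bool" where
  "tile D \<longleftrightarrow> D \<noteq> {} \<and> compact D \<and> connected D \<and> closure (interior D) = D"

definition tiling :: "(real ^ 'n) set set \<Rightarrow> bool" where
  "tiling x \<longleftrightarrow>
     (\<forall>D\<in>x. tile D) \<and>
     pairwise (\<lambda>D E. interior D \<inter> interior E = {}) x \<and>
     \<Union>x = UNIV"

definition tile_equiv :: "((real ^ 'n) set \<times> (real ^ 'n) set) set" where
  "tile_equiv = {(D, E). tile D \<and> tile E \<and> (\<exists>v. E = (\<lambda>p. p + v) ` D)}"

text \<open>A prototile is an equivalence class, i.e. a set of tiles.\<close>

definition prototiles :: "(real ^ 'n) set set set" where
  "prototiles = {D. tile D} // tile_equiv"

definition full_tiling_space :: "(real ^ 'n) set set set \<Rightarrow> (real ^ 'n) set set set" where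
  "full_tiling_space \<T> = {x. tiling x \<and> (\<forall>D\<in>x. \<exists>P\<in>\<T>. D \<in> P)}"

definition supp :: "(real ^ 'n) set set \<Rightarrow> (real ^ 'n) set" where
  "supp y = \<Union>y"

definition patch :: "(real ^ 'n) set set set \<Rightarrow> (real ^ 'n) set set \<Rightarrow> bool" where
  "patch \<T> y \<longleftrightarrow>
     y \<noteq> {} \<and> finite y \<and> (\<exists>x\<in>full_tiling_space \<T>. y \<subseteq> x) \<and> connected (supp y)"

definition translate :: "real ^ 'n \<Rightarrow> (real ^ 'n) set set \<Rightarrow> (real ^ 'n) set set" where
  "translate v x = (\<lambda>D. (\<lambda>p. p - v) ` D) ` x"

text \<open>The set of patches written \<open>x[[K]]\<close>.\<close>

definition patches_covering ::
  "(real ^ 'n) set set set \<Rightarrow> (real ^ 'n) set set \<Rightarrow> (real ^ 'n) set \<Rightarrow> (real ^ 'n) set set set" where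
  "patches_covering \<T> x K = {x'. patch \<T> x' \<and> x' \<subseteq> x \<and> K \<subseteq> supp x'}"

text \<open>The infimum is taken in the extended reals, where the infimum of the empty set is \<open>\<infinity>\<close>.\<close>

definition pre_tiling_dist ::
  "(real ^ 'n \<Rightarrow> real) \<Rightarrow> (real ^ 'n) set set set \<Rightarrow>
   (real ^ 'n) set set \<Rightarrow> (real ^ 'n) set set \<Rightarrow> ereal" where
  "pre_tiling_dist N \<T> x y =
     Inf (ereal ` {r. 0 < r \<and> r < 1 / sqrt 2 \<and>
       (\<exists>x'\<in>patches_covering \<T> x (norm_ball N (1 / r)).
        \<exists>y'\<in>patches_covering \<T> y (norm_ball N (1 / r)).
        \<exists>v\<in>norm_ball N r. translate v x' = y')})"

definition tiling_dist ::
  "(real ^ 'n \<Rightarrow> real) \<Rightarrow> (real ^ 'n) set set set \<Rightarrow>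
   (real ^ 'n) set set \<Rightarrow> (real ^ 'n) set set \<Rightarrow> real" where
  "tiling_dist N \<T> x y =
     real_of_ereal (min (ereal (1 / sqrt 2)) (pre_tiling_dist N \<T> x y))"

text \<open>
  The metric topology on the full tiling space: a set is open iff it contains an open ball around
  each of its points. Unfolding \<open>Metric_space.mtopology\<close> by library facts requires
  \<open>Metric_space (full_tiling_space \<T>) (tiling_dist N \<T>)\<close>, which is a consequence of the
  definitions when \<open>N\<close> is a norm and \<open>\<T>\<close> is a finite set of prototiles.
\<close>

definition tiling_topology ::
  "(real ^ 'n \<Rightarrow> real) \<Rightarrow> (real ^ 'n) set set set \<Rightarrow> (real ^ 'n) set set topology" where
  "tiling_topology N \<T> =
     Metric_space.mtopology (full_tiling_space \<T>) (tiling_dist N \<T>)"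

end

theory Submission
  imports Defs
begin

text \<open>
  If \<open>T\<^sub>w x' = y'\<close> with \<open>x'\<close>, \<open>y'\<close> covering the ball of radius \<open>1 / r\<close> and \<open>N w \<le> r\<close>, then
  \<open>T\<^sub>v x'\<close> is carried to \<open>T\<^bsub>v'\<^esub> y'\<close> by a vector of length at most \<open>r + N (v' - v)\<close>, and both
  cover the ball of radius \<open>1 / r - max (N v) (N v')\<close>; this gives continuity once \<open>d\<^sub>1\<close> is known
  to be a metric. The metric axioms rest on the local finiteness of tilings by finitely many
  prototiles and on the fact that a patch contains every tile that meets the interior of its support.
\<close>

subsection \<open>Norms\<close>

lemma
  assumes "is_norm N"
  shows is_norm_ge_0: "0 \<le> N p"
    and is_norm_eq_0: "N p = 0 \<longleftrightarrow> p = 0"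
    and is_norm_scaleR: "N (c *\<^sub>R p) = \<bar>c\<bar> * N p"
    and is_norm_triangle: "N (p + q) \<le> N p + N q"
  using assms by (auto simp: is_norm_def)

lemma is_norm_minus: "is_norm N \<Longrightarrow> N (- p) = N p"
  using is_norm_scaleR[of N "-1" p] by simp

lemma is_norm_0: "is_norm N \<Longrightarrow> N 0 = 0"
  by (simp add: is_norm_eq_0)

lemma is_norm_triangle_diff: "is_norm N \<Longrightarrow> N (p - q) \<le> N p + N q"
  using is_norm_triangle[of N p "- q"] by (simp add: is_norm_minus)

text \<open>Expand \<open>p\<close> in the standard basis; each coordinate is at most
  \<open>norm p\<close> in absolute value. The comparison serves to make \<open>N\<close>
  continuous.\<close>

lemma is_norm_le_norm:
  assumes "is_norm N"
  obtains C where "C > 0" "\<And>p. N p \<le> C * norm p"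
proof
  let ?C = "\<Sum>i\<in>Basis. N i"
  have sum_le: "N (sum f A) \<le> (\<Sum>i\<in>A. N (f i))" if "finite A" for A :: "(real^'a) set" and f
    using that
  proof (induction A)
    case (insert i A)
    then show ?case
      using is_norm_triangle[OF assms, of "f i" "sum f A"] by simp
  qed (simp add: is_norm_0 assms)
  show "?C + 1 > 0"
    using sum_nonneg[of Basis N] is_norm_ge_0[OF assms] by (smt (verit))
  fix p
  have "N p = N (\<Sum>i\<in>Basis. (p \<bullet> i) *\<^sub>R i)"
    by (simp add: euclidean_representation)
  also have "\<dots> \<le> (\<Sum>i\<in>Basis. N ((p \<bullet> i) *\<^sub>R i))"
    by (rule sum_le) simp
  also have "\<dots> = (\<Sum>i\<in>Basis. \<bar>p \<bullet> i\<bar> * N i)"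
    by (simp add: is_norm_scaleR[OF assms])
  also have "\<dots> \<le> (\<Sum>i\<in>Basis. norm p * N i)"
    by (intro sum_mono mult_right_mono) (auto simp: Basis_le_norm is_norm_ge_0 assms)
  also have "\<dots> \<le> (?C + 1) * norm p"
    by (simp add: sum_distrib_left algebra_simps)
  finally show "N p \<le> (?C + 1) * norm p" .
qed

lemma continuous_on_is_norm:
  assumes "is_norm N"
  shows "continuous_on S N"
proof -
  obtain C where C: "C > 0" "\<And>p. N p \<le> C * norm p"
    using is_norm_le_norm[OF assms] by blast
  have "dist (N p) (N q) \<le> C * dist p q" for p q
    using is_norm_triangle[OF assms, of "p - q" q] is_norm_triangle[OF assms, of "q - p" p]
      C(2)[of "p - q"] C(2)[of "q - p"]
    by (simp add: dist_norm norm_minus_commute abs_le_iff)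
  then have "C-lipschitz_on S N"
    using C(1) by (intro lipschitz_onI) auto
  then show ?thesis
    by (rule lipschitz_on_continuous_on)
qed

lemma open_is_norm_ball: "is_norm N \<Longrightarrow> open {p. N (p - a) < r}"
  by (intro open_Collect_less continuous_on_const
      continuous_on_compose2[OF continuous_on_is_norm[of N UNIV]] continuous_intros) auto

text \<open>The Euclidean unit sphere is compact, so \<open>N\<close> attains a minimum there, which
  is positive; homogeneity extends the bound to all vectors.\<close>

lemma norm_le_is_norm:
  fixes N :: "real ^ 'n \<Rightarrow> real"
  assumes "is_norm N"
  obtains c where "c > 0" "\<And>p. norm p \<le> c * N p"
proof -
  have "sphere (0 :: real ^ 'n) 1 \<noteq> {}"
    by simp
  then obtain p0 :: "real ^ 'n" where p0: "norm p0 = 1" "\<And>p. norm p = 1 \<Longrightarrow> N p0 \<le> N p"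
    using continuous_attains_inf[of "sphere 0 1" N] continuous_on_is_norm[OF assms] by auto
  have pos: "N p0 > 0"
    using p0(1) is_norm_ge_0[OF assms, of p0] is_norm_eq_0[OF assms, of p0] by fastforce
  have "norm p \<le> (1 / N p0) * N p" for p
  proof (cases "p = 0")
    case False
    then have "N p0 \<le> N ((1 / norm p) *\<^sub>R p)"
      by (intro p0(2)) simp
    then show ?thesis
      using False pos by (simp add: is_norm_scaleR[OF assms] field_simps)
  qed (simp add: is_norm_0 assms)
  then show thesis
    using pos that[of "1 / N p0"] by simp
qed

lemma bounded_norm_ball:
  assumes "is_norm N"
  shows "bounded (norm_ball N r)"
proof -
  obtain c where "c > 0" "\<And>p. norm p \<le> c * N p"
    using norm_le_is_norm[OF assms] by blast
  then have "norm p \<le> c * r" if "p \<in> norm_ball N r" for p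
    using that by (smt (verit) mem_Collect_eq mult_left_mono norm_ball_def)
  then show ?thesis
    unfolding bounded_iff by blast
qed

lemma convex_norm_ball:
  assumes "is_norm N"
  shows "convex (norm_ball N r)"
proof (rule convexI)
  fix p q and a b :: real
  assume *: "p \<in> norm_ball N r" "q \<in> norm_ball N r" "0 \<le> a" "0 \<le> b" "a + b = 1"
  have "N (a *\<^sub>R p + b *\<^sub>R q) \<le> a * N p + b * N q"
    using is_norm_triangle[OF assms, of "a *\<^sub>R p" "b *\<^sub>R q"] * by (simp add: is_norm_scaleR[OF assms])
  also have "\<dots> \<le> a * r + b * r"
    using * by (intro add_mono mult_left_mono) (auto simp: norm_ball_def)
  also have "\<dots> = r"
    using * by (simp flip: distrib_right)
  finally show "a *\<^sub>R p + b *\<^sub>R q \<in> norm_ball N r"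
    by (simp add: norm_ball_def)
qed

subsection \<open>Translations\<close>

lemma translate_0 [simp]: "translate 0 x = x"
  by (simp add: translate_def)

lemma translate_translate [simp]: "translate v (translate w x) = translate (w + v) x"
  by (simp add: translate_def image_image diff_diff_eq)

lemma translate_mono: "x \<subseteq> y \<Longrightarrow> translate v x \<subseteq> translate v y"
  by (auto simp: translate_def)

lemma mem_supp_translate: "p \<in> supp (translate v x) \<longleftrightarrow> p + v \<in> supp x"
  by (force simp: supp_def translate_def image_iff)

lemma supp_translate: "supp (translate v x) = (\<lambda>p. p - v) ` supp x"
  by (auto simp: supp_def translate_def)

lemma tile_translate: "tile D \<Longrightarrow> tile ((\<lambda>p. p - v) ` D)"
  by (auto simp: tile_def compact_translation_subtract interior_translation_subtract
      closure_translation_subtract intro!: connected_continuous_image continuous_intros)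

lemma tiling_translate:
  assumes "tiling x"
  shows "tiling (translate v x)"
  unfolding tiling_def
proof (intro conjI ballI)
  show "tile D" if "D \<in> translate v x" for D
    using that assms by (auto simp: translate_def tiling_def tile_translate)
  have inj: "inj_on (\<lambda>p. p - v) S" for S
    by (simp add: inj_on_def)
  have "interior ((\<lambda>p. p - v) ` D) \<inter> interior ((\<lambda>p. p - v) ` E) = {}"
    if "D \<in> x" "E \<in> x" "D \<noteq> E" for D E
  proof -
    have "interior D \<inter> interior E = {}"
      using that assms by (simp add: tiling_def pairwise_def)
    then show ?thesis
      by (simp add: interior_translation_subtract flip: image_Int[OF inj])
  qed
  then show "pairwise (\<lambda>D E. interior D \<inter> interior E = {}) (translate v x)"
    unfolding translate_def pairwise_def by blast
  have "\<Union>x = UNIV"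
    using assms by (simp add: tiling_def)
  then show "\<Union>(translate v x) = UNIV"
    using mem_supp_translate[of _ v x] by (auto simp: supp_def)
qed

lemma prototiles_translate:
  assumes "P \<in> prototiles" "D \<in> P"
  shows "(\<lambda>p. p - v) ` D \<in> P"
proof -
  obtain D0 where P: "P = tile_equiv `` {D0}"
    using assms(1) by (auto simp: prototiles_def quotient_def)
  with assms(2) obtain w where w: "tile D0" "tile D" "D = (\<lambda>p. p + w) ` D0"
    by (auto simp: tile_equiv_def)
  have "(\<lambda>p. p - v) ` D = (\<lambda>p. p + (w - v)) ` D0"
    using w(3) by (simp add: image_image algebra_simps)
  then show ?thesis
    using P w tile_translate[of D v] by (auto simp: tile_equiv_def)
qed

lemma full_tiling_space_translate:
  assumes "\<T> \<subseteq> prototiles" "x \<in> full_tiling_space \<T>"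
  shows "translate v x \<in> full_tiling_space \<T>"
  unfolding full_tiling_space_def
proof (intro CollectI conjI ballI)
  show "tiling (translate v x)"
    using assms(2) by (simp add: full_tiling_space_def tiling_translate)
  fix E assume "E \<in> translate v x"
  then obtain D where D: "D \<in> x" "E = (\<lambda>p. p - v) ` D"
    by (auto simp: translate_def)
  then obtain P where "P \<in> \<T>" "D \<in> P"
    using assms(2) by (auto simp: full_tiling_space_def)
  then show "\<exists>P\<in>\<T>. E \<in> P"
    using D prototiles_translate assms(1) by blast
qed

lemma patch_translate:
  assumes "\<T> \<subseteq> prototiles" "patch \<T> y"
  shows "patch \<T> (translate v y)"
  unfolding patch_def
proof (intro conjI)
  show "translate v y \<noteq> {}" "finite (translate v y)"
    using assms(2) by (auto simp: patch_def translate_def)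
  show "\<exists>x\<in>full_tiling_space \<T>. translate v y \<subseteq> x"
    using assms by (meson full_tiling_space_translate patch_def translate_mono)
  show "connected (supp (translate v y))"
    using assms(2) unfolding supp_translate patch_def
    by (intro connected_continuous_image continuous_intros) auto
qed

text \<open>\<open>translate v\<close> subtracts \<open>v\<close> from points, hence the sign in the
  condition. \<open>L\<close> is left free so that it may be the shifted set or a smaller
  ball.\<close>

lemma patches_covering_translate:
  assumes "\<T> \<subseteq> prototiles" "x' \<in> patches_covering \<T> x K" "\<And>p. p \<in> L \<Longrightarrow> p + v \<in> K"
  shows "translate v x' \<in> patches_covering \<T> (translate v x) L"
  using assms
  by (auto simp: patches_covering_def mem_supp_translate patch_translate subset_iff[of K]
      dest: translate_mono)

text \<open>Rigidity: a point of \<open>D\<close> extremal in the direction \<open>v - w\<close> would be moved outside \<open>D\<close>.\<close>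

lemma compact_translate_eqD:
  fixes D :: "'a::euclidean_space set"
  assumes "compact D" "D \<noteq> {}" "(\<lambda>p. p - v) ` D = (\<lambda>p. p - w) ` D"
  shows "v = w"
proof -
  obtain p where p: "p \<in> D" "\<And>q. q \<in> D \<Longrightarrow> q \<bullet> (v - w) \<le> p \<bullet> (v - w)"
    using continuous_attains_sup[OF assms(1,2), of "\<lambda>q. q \<bullet> (v - w)"]
      continuous_on_inner[OF continuous_on_id continuous_on_const] by blast
  obtain q where "q \<in> D" "p - w = q - v"
    using assms(3) p(1) by blast
  then have "p + (v - w) \<in> D"
    by (simp add: algebra_simps)
  from p(2)[OF this] have "(v - w) \<bullet> (v - w) \<le> 0"
    by (simp add: inner_add_left)
  then show ?thesis
    by (metis inner_gt_zero_iff not_le right_minus_eq)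
qed

subsection \<open>Tiles meeting a set\<close>

lemma tiling_eqI:
  assumes "tiling x" "D \<in> x" "E \<in> x" "p \<in> interior D" "p \<in> interior E"
  shows "D = E"
  using assms by (auto simp: tiling_def pairwise_def)

lemma tile_interior_nonempty: "tile D \<Longrightarrow> interior D \<noteq> {}"
  unfolding tile_def by (metis closure_empty)

lemma tiling_tile: "tiling x \<Longrightarrow> D \<in> x \<Longrightarrow> tile D"
  by (simp add: tiling_def)

text \<open>A tile is the closure of its interior, so interior points come arbitrarily close to each
  of its points.\<close>

lemma tile_meets_open:
  assumes "tile D" "open U" "D \<inter> U \<noteq> {}"
  shows "interior D \<inter> U \<noteq> {}"
  using assms open_Int_closure_eq_empty[of U "interior D"] by (auto simp: tile_def)

text \<open>Some interior point of \<open>D\<close> lies in \<open>U\<close>, hence in a tile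
  \<open>E\<close> of \<open>y'\<close>; then the interiors of \<open>D\<close> and \<open>E\<close>
  meet and the tiles coincide. Openness of \<open>U\<close> excludes contact along the boundary of
  \<open>D\<close> alone.\<close>

lemma tile_mem_if_meets_open_subset_supp:
  assumes "tiling y" "y' \<subseteq> y" "open U" "U \<subseteq> supp y'" "D \<in> y" "D \<inter> U \<noteq> {}"
  shows "D \<in> y'"
proof -
  obtain p where p: "p \<in> interior D" "p \<in> U"
    using tile_meets_open[of D U] assms tiling_tile by blast
  then obtain E where E: "E \<in> y'" "p \<in> E"
    using assms(4) by (auto simp: supp_def)
  then obtain q where "q \<in> interior E" "q \<in> interior D"
    using tile_meets_open[of E "interior D"] p assms(1,2) tiling_tile by blast
  then show ?thesis
    using tiling_eqI[of y D E q] E assms by blast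
qed

definition tiles_meeting :: "(real ^ 'n) set set \<Rightarrow> (real ^ 'n) set \<Rightarrow> (real ^ 'n) set set" where
  "tiles_meeting x K = {D \<in> x. D \<inter> K \<noteq> {}}"

text \<open>Uniform separation makes \<open>S\<close> closed, hence compact. By Bolzano-Weierstrass
  an infinite \<open>S\<close> would have an accumulation point in \<open>S\<close>, against
  separation.\<close>

lemma finite_if_bounded_uniformly_separated:
  fixes S :: "'a::heine_borel set"
  assumes "bounded S" "e > 0" "\<And>v w. v \<in> S \<Longrightarrow> w \<in> S \<Longrightarrow> dist w v < e \<Longrightarrow> w = v"
  shows "finite S"
proof (rule ccontr)
  assume "infinite S"
  moreover have "compact S"
    using assms discrete_imp_closed[of e S] by (auto simp: compact_eq_bounded_closed)
  ultimately obtain v where "v \<in> S" "v islimpt S"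
    using compact_eq_Bolzano_Weierstrass by blast
  then show False
    using assms(2,3) by (metis islimpt_approachable)
qed

text \<open>Translation vectors of tiles from one prototile are separated by the inradius of that tile.\<close>

lemma finite_tiles_meeting_prototile:
  fixes x :: "(real ^ 'n) set set"
  assumes "tiling x" "P \<in> prototiles" "bounded K"
  shows "finite {D \<in> x \<inter> P. D \<inter> K \<noteq> {}}"
proof -
  obtain D0 where P: "P = tile_equiv `` {D0}" "tile D0"
    using assms(2) by (auto simp: prototiles_def quotient_def)
  define S where "S = {v. (\<lambda>p. p + v) ` D0 \<in> x \<and> (\<lambda>p. p + v) ` D0 \<inter> K \<noteq> {}}"
  obtain c where c: "c \<in> interior D0"
    using tile_interior_nonempty[OF P(2)] by blast
  then obtain e where e: "e > 0" "ball c e \<subseteq> interior D0"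
    by (meson open_contains_ball open_interior)
  have "finite S"
  proof (rule finite_if_bounded_uniformly_separated[OF _ e(1)])
    \<comment> \<open>The translate of \<open>D0\<close> by \<open>v\<close> meets \<open>K\<close>
      only if \<open>v\<close> is a difference of a point of \<open>K\<close> and a point of
      \<open>D0\<close>.\<close>
    have "bounded ((\<lambda>(k, d). k - d) ` (K \<times> D0))"
      using assms(3) P(2) by (intro bounded_minus) (auto simp: tile_def compact_imp_bounded)
    moreover have "S \<subseteq> ((\<lambda>(k, d). k - d) ` (K \<times> D0))"
      by (force simp: S_def)
    ultimately show "bounded S"
      by (rule bounded_subset)
    fix v w assume vw: "v \<in> S" "w \<in> S" "dist w v < e"
    have int: "p \<in> interior ((\<lambda>q. q + u) ` D0) \<longleftrightarrow> p - u \<in> interior D0" for p u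
      using interior_translation_subtract[of "- u" D0] by (force simp: image_iff)
    \<comment> \<open>Thus \<open>c + w\<close> is interior to both translates of \<open>D0\<close>,
      which are then the same tile; rigidity gives \<open>w = v\<close>.\<close>
    have "c + w - v \<in> interior D0"
      using e(2) vw(3) by (auto simp: subset_iff dist_norm norm_minus_commute algebra_simps)
    then have "(\<lambda>p. p + v) ` D0 = (\<lambda>p. p + w) ` D0"
      using tiling_eqI[OF assms(1), of "(\<lambda>p. p + v) ` D0" "(\<lambda>p. p + w) ` D0" "c + w"] vw c
      by (auto simp: S_def int)
    then show "w = v"
      using compact_translate_eqD[of D0 "- w" "- v"] P(2) by (simp add: tile_def)
  qed
  moreover have "{D \<in> x \<inter> P. D \<inter> K \<noteq> {}} \<subseteq> (\<lambda>v. (\<lambda>p. p + v) ` D0) ` S"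
    using P by (auto simp: tile_equiv_def S_def)
  ultimately show ?thesis
    using finite_surj by blast
qed

lemma finite_tiles_meeting:
  assumes "finite \<T>" "\<T> \<subseteq> prototiles" "x \<in> full_tiling_space \<T>" "bounded K"
  shows "finite (tiles_meeting x K)"
proof -
  have "tiles_meeting x K \<subseteq> (\<Union>P\<in>\<T>. {D \<in> x \<inter> P. D \<inter> K \<noteq> {}})"
    using assms(3) by (auto simp: tiles_meeting_def full_tiling_space_def)
  moreover have "finite (\<Union>P\<in>\<T>. {D \<in> x \<inter> P. D \<inter> K \<noteq> {}})"
    using assms finite_tiles_meeting_prototile
    by (intro finite_UN_I) (auto simp: full_tiling_space_def)
  ultimately show ?thesis
    by (rule finite_subset)
qed

text \<open>The union of \<open>K\<close> with a tile meeting it is connected, and all these unions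
  share \<open>K\<close>. Together they form the support, because \<open>K\<close> is already
  covered by the tiles.\<close>

lemma tiles_meeting_patches_covering:
  assumes "finite \<T>" "\<T> \<subseteq> prototiles" "x \<in> full_tiling_space \<T>"
    and K: "bounded K" "connected K" "K \<noteq> {}"
  shows "tiles_meeting x K \<in> patches_covering \<T> x K"
proof -
  have x: "tiling x"
    using assms(3) by (simp add: full_tiling_space_def)
  have cov: "K \<subseteq> supp (tiles_meeting x K)"
  proof
    fix p assume p: "p \<in> K"
    have "\<Union>x = UNIV"
      using x by (simp add: tiling_def)
    then obtain D where "D \<in> x" "p \<in> D"
      by (metis UNIV_I UnionE)
    with p show "p \<in> supp (tiles_meeting x K)"
      by (auto simp: supp_def tiles_meeting_def)
  qed
  have "connected (\<Union>D\<in>tiles_meeting x K. D \<union> K)"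
  proof (rule connected_Union)
    show "connected C" if "C \<in> (\<lambda>D. D \<union> K) ` tiles_meeting x K" for C
      using that K x tiling_tile by (fastforce simp: tiles_meeting_def tile_def intro: connected_Un)
    show "\<Inter> ((\<lambda>D. D \<union> K) ` tiles_meeting x K) \<noteq> {}"
      using K by blast
  qed
  moreover have "(\<Union>D\<in>tiles_meeting x K. D \<union> K) = supp (tiles_meeting x K)"
    using cov by (auto simp: supp_def)
  moreover have "tiles_meeting x K \<noteq> {}"
    using cov K by (auto simp: supp_def)
  moreover have "tiles_meeting x K \<subseteq> x"
    by (auto simp: tiles_meeting_def)
  ultimately show ?thesis
    using cov assms finite_tiles_meeting[OF assms(1-3) K(1)]
    by (auto simp: patches_covering_def patch_def)
qed

text \<open>\<open>patch\<close> does not refer to the surrounding tiling, so a patch may be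
  reassigned to any set of tiles that contains it.\<close>

lemma patches_covering_sub:
  assumes "q \<in> patches_covering \<T> x K" "q \<subseteq> y" "L \<subseteq> K"
  shows "q \<in> patches_covering \<T> y L"
  using assms by (auto simp: patches_covering_def)

subsection \<open>The tiling metric\<close>

text \<open>Isolates the condition under the infimum in \<open>pre_tiling_dist\<close>, without the
  bounds on \<open>r\<close>.\<close>

definition close_tilings ::
  "(real ^ 'n \<Rightarrow> real) \<Rightarrow> (real ^ 'n) set set set \<Rightarrow> real \<Rightarrow>
   (real ^ 'n) set set \<Rightarrow> (real ^ 'n) set set \<Rightarrow> bool" where
  "close_tilings N \<T> r x y \<longleftrightarrow>
     (\<exists>x'\<in>patches_covering \<T> x (norm_ball N (1 / r)).
      \<exists>y'\<in>patches_covering \<T> y (norm_ball N (1 / r)).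
      \<exists>v\<in>norm_ball N r. translate v x' = y')"

lemma pre_tiling_dist_nonneg: "0 \<le> pre_tiling_dist N \<T> x y"
  unfolding pre_tiling_dist_def by (intro Inf_greatest) auto

text \<open>The minimum lies between 0 and \<open>1 / sqrt 2\<close>, so
  \<open>real_of_ereal\<close> never meets an infinite value, which it would send to 0.\<close>

lemma ereal_tiling_dist:
  "ereal (tiling_dist N \<T> x y) = min (ereal (1 / sqrt 2)) (pre_tiling_dist N \<T> x y)"
proof -
  have "0 \<le> min (ereal (1 / sqrt 2)) (pre_tiling_dist N \<T> x y)"
    using pre_tiling_dist_nonneg by simp
  moreover have "min (ereal (1 / sqrt 2)) (pre_tiling_dist N \<T> x y) \<le> ereal (1 / sqrt 2)"
    by simp
  ultimately show ?thesis
    unfolding tiling_dist_def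
    by (metis (no_types, lifting) ereal_infty_less_eq(1) ereal_real' abs_ereal_ge0
        PInfty_neq_ereal(1))
qed

text \<open>A strict bound on an infimum yields a witness whether or not the infimum is attained.
  The first disjunct comes from the cap on the distance.\<close>

lemma tiling_dist_less_iff:
  "tiling_dist N \<T> x y < e \<longleftrightarrow>
     1 / sqrt 2 < e \<or> (\<exists>r. 0 < r \<and> r < 1 / sqrt 2 \<and> r < e \<and> close_tilings N \<T> r x y)"
proof -
  have "tiling_dist N \<T> x y < e \<longleftrightarrow> ereal (tiling_dist N \<T> x y) < ereal e"
    by simp
  also have "\<dots> \<longleftrightarrow> 1 / sqrt 2 < e \<or> pre_tiling_dist N \<T> x y < ereal e"
    unfolding ereal_tiling_dist min_less_iff_disj by simp
  also have "pre_tiling_dist N \<T> x y < ereal e \<longleftrightarrow>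
      (\<exists>r. 0 < r \<and> r < 1 / sqrt 2 \<and> r < e \<and> close_tilings N \<T> r x y)"
    unfolding pre_tiling_dist_def Inf_less_iff close_tilings_def[symmetric] by auto
  finally show ?thesis .
qed

lemma close_tilings_sym:
  assumes "is_norm N" "close_tilings N \<T> r x y"
  shows "close_tilings N \<T> r y x"
proof -
  obtain x' v where "x' \<in> patches_covering \<T> x (norm_ball N (1 / r))" "v \<in> norm_ball N r"
    "translate v x' \<in> patches_covering \<T> y (norm_ball N (1 / r))"
    using assms(2) by (auto simp: close_tilings_def)
  moreover have "translate (- v) (translate v x') = x'" "- v \<in> norm_ball N r"
    using \<open>v \<in> norm_ball N r\<close> by (auto simp: norm_ball_def is_norm_minus assms(1))
  ultimately show ?thesis
    unfolding close_tilings_def by metis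
qed

lemma close_tilings_refl:
  assumes "is_norm N" "finite \<T>" "\<T> \<subseteq> prototiles" "x \<in> full_tiling_space \<T>" "r > 0"
  shows "close_tilings N \<T> r x x"
proof -
  have "0 \<in> norm_ball N (1 / r)" "0 \<in> norm_ball N r"
    using assms(1,5) by (auto simp: norm_ball_def is_norm_0)
  moreover from this have
    "tiles_meeting x (norm_ball N (1 / r)) \<in> patches_covering \<T> x (norm_ball N (1 / r))"
    using assms by (intro tiles_meeting_patches_covering)
      (auto simp: bounded_norm_ball convex_norm_ball convex_connected)
  ultimately show ?thesis
    unfolding close_tilings_def by force
qed

text \<open>The patch of \<open>y\<close> connecting \<open>x\<close> to \<open>z\<close> consists of the tiles meeting \<open>(B - v) \<union> (B + w)\<close>
  with \<open>B\<close> of radius \<open>1 / (r + s)\<close>; this set lies in the interior of the supports of both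
  given patches of \<open>y\<close>, so these patches contain all those tiles.\<close>

lemma close_tilings_trans:
  fixes N :: "real ^ 'n \<Rightarrow> real"
  assumes "is_norm N" "finite \<T>" "\<T> \<subseteq> prototiles" "y \<in> full_tiling_space \<T>"
    and r: "r > 0" and s: "s > 0" and rs: "r + s < 1"
    and xy: "close_tilings N \<T> r x y" and yz: "close_tilings N \<T> s y z"
  shows "close_tilings N \<T> (r + s) x z"
proof -
  obtain x' v where x': "x' \<in> patches_covering \<T> x (norm_ball N (1 / r))" "N v \<le> r"
    and y1: "translate v x' \<in> patches_covering \<T> y (norm_ball N (1 / r))"
    using xy by (auto simp: close_tilings_def norm_ball_def)
  obtain y2 w where y2: "y2 \<in> patches_covering \<T> y (norm_ball N (1 / s))" "N w \<le> s"
    and z': "translate w y2 \<in> patches_covering \<T> z (norm_ball N (1 / s))"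
    using yz by (auto simp: close_tilings_def norm_ball_def)
  define R where "R = 1 / (r + s)"
  have R: "R < 1 / r" "R < 1 / s" "r \<le> R" "s \<le> R"
  proof -
    show "R < 1 / r" "R < 1 / s"
      using r s by (auto simp: R_def field_simps)
    have "1 \<le> R"
      using rs r s by (simp add: R_def field_simps)
    then show "r \<le> R" "s \<le> R"
      using rs r s by auto
  qed
  \<comment> \<open>As \<open>r + s < 1\<close>, shrinking the radius from \<open>1 / s\<close> to
    \<open>R\<close> leaves room for a shift of length \<open>r\<close>.\<close>
  have Rr: "R + r < 1 / s"
  proof -
    have "1 / s - R = r / (s * (r + s))"
      using r s by (simp add: R_def field_simps)
    also have "\<dots> > r / 1"
      using r s rs mult_strict_mono[of s 1 "r + s" 1] by (intro divide_strict_left_mono) auto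
    finally show ?thesis by simp
  qed
  have Rs: "R + s < 1 / r"
  proof -
    have "1 / r - R = s / (r * (r + s))"
      using r s by (simp add: R_def field_simps)
    also have "\<dots> > s / 1"
      using r s rs mult_strict_mono[of r 1 "r + s" 1] by (intro divide_strict_left_mono) auto
    finally show ?thesis by simp
  qed
  \<comment> \<open>\<open>translate (- v) q\<close> and \<open>translate w q\<close> cover the ball
    of radius \<open>R\<close> exactly when \<open>q\<close> covers \<open>A\<close> and
    \<open>B\<close>, respectively.\<close>
  define A where "A = (\<lambda>p. p - v) ` norm_ball N R"
  define B where "B = (\<lambda>p. p + w) ` norm_ball N R"
  define q where "q = tiles_meeting y (A \<union> B)"
  have memA: "N (p + v) \<le> R" if "p \<in> A" for p
    using that by (auto simp: A_def norm_ball_def)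
  have memB: "N (p - w) \<le> R" if "p \<in> B" for p
    using that by (auto simp: B_def norm_ball_def)
  have NA: "N p \<le> R + r" if "p \<in> A" for p
    using memA[OF that] is_norm_triangle_diff[OF assms(1), of "p + v" v] x'(2) by simp
  have NB: "N p \<le> R + s" if "p \<in> B" for p
    using memB[OF that] is_norm_triangle[OF assms(1), of "p - w" w] y2(2) by simp
  have q: "q \<in> patches_covering \<T> y (A \<union> B)"
    unfolding q_def
  proof (rule tiles_meeting_patches_covering[OF assms(2-4)])
    show "bounded (A \<union> B)"
      using bounded_norm_ball[OF assms(1), of R] bounded_translation_minus[of "norm_ball N R" v]
        bounded_translation[of "norm_ball N R" w]
      by (simp add: A_def B_def add.commute)
    \<comment> \<open>The common point 0 makes the union of the two connected sets connected; it
      lies in both since \<open>N v \<le> r \<le> R\<close> and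
      \<open>N w \<le> s \<le> R\<close>.\<close>
    have "0 \<in> A" "0 \<in> B"
      using R x'(2) y2(2)
      by (auto simp: A_def B_def norm_ball_def image_iff is_norm_minus[OF assms(1)]
          intro: exI[of _ v] exI[of _ "- w"])
    moreover have "connected A" "connected B"
      unfolding A_def B_def using convex_connected[OF convex_norm_ball[OF assms(1), of R]]
      by (auto intro!: connected_continuous_image continuous_intros)
    ultimately show "connected (A \<union> B)" "A \<union> B \<noteq> {}"
      by (auto intro: connected_Un)
  qed
  have y: "tiling y"
    using assms(4) by (simp add: full_tiling_space_def)
  have "q \<subseteq> translate v x'"
  proof
    fix D assume "D \<in> q"
    then have D: "D \<in> y" "D \<inter> (A \<union> B) \<noteq> {}"
      by (auto simp: q_def tiles_meeting_def)
    \<comment> \<open>The ball about \<open>- v\<close> is covered because \<open>x'\<close> covers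
      the ball about 0 before the translation; it contains \<open>A\<close>. The ball about 0
      contains \<open>B\<close> by \<open>Rs\<close>.\<close>
    let ?U = "{p. N (p - - v) < 1 / r} \<union> {p. N (p - 0) < 1 / r}"
    show "D \<in> translate v x'"
    proof (rule tile_mem_if_meets_open_subset_supp[OF y _ _ _ D(1)])
      show "translate v x' \<subseteq> y"
        using y1 by (simp add: patches_covering_def)
      show "open ?U"
        by (intro open_Un open_is_norm_ball assms)
      show "?U \<subseteq> supp (translate v x')"
        using x'(1) y1 by (auto simp: patches_covering_def mem_supp_translate norm_ball_def subset_iff)
      show "D \<inter> ?U \<noteq> {}"
        using D(2) memA NB R(1) Rs by fastforce
    qed
  qed
  moreover have "q \<subseteq> y2"
  proof
    fix D assume "D \<in> q"
    then have D: "D \<in> y" "D \<inter> (A \<union> B) \<noteq> {}"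
      by (auto simp: q_def tiles_meeting_def)
    \<comment> \<open>The roles are exchanged: the ball about \<open>w\<close>, pulled back from the
      patch of \<open>z\<close>, contains \<open>B\<close>, and the ball about 0 contains
      \<open>A\<close> by \<open>Rr\<close>.\<close>
    let ?U = "{p. N (p - w) < 1 / s} \<union> {p. N (p - 0) < 1 / s}"
    show "D \<in> y2"
    proof (rule tile_mem_if_meets_open_subset_supp[OF y _ _ _ D(1)])
      show "y2 \<subseteq> y"
        using y2 by (simp add: patches_covering_def)
      show "open ?U"
        by (intro open_Un open_is_norm_ball assms)
      have "p \<in> supp y2" if "N (p - w) < 1 / s" for p
        using that z' mem_supp_translate[of "p - w" w y2]
        by (auto simp: patches_covering_def norm_ball_def subset_iff)
      then show "?U \<subseteq> supp y2"
        using y2(1) by (auto simp: patches_covering_def norm_ball_def subset_iff)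
      show "D \<inter> ?U \<noteq> {}"
        using D(2) memB NA R(2) Rr by fastforce
    qed
  qed
  moreover have "translate (- v) q \<in> patches_covering \<T> (translate (- v) y) (norm_ball N R)"
    by (rule patches_covering_translate[OF assms(3) q]) (auto simp: A_def)
  moreover have "translate w q \<in> patches_covering \<T> (translate w y) (norm_ball N R)"
    by (rule patches_covering_translate[OF assms(3) q]) (auto simp: B_def)
  moreover have "x' \<subseteq> x" "translate w y2 \<subseteq> z"
    using x'(1) z' by (auto simp: patches_covering_def)
  moreover have "translate (- v) (translate v x') = x'"
    by simp
  \<comment> \<open>Since \<open>q\<close> lies in both patches of \<open>y\<close>, its two shifts
    lie in \<open>x'\<close> and in \<open>translate w y2\<close>, hence in \<open>x\<close> and
    \<open>z\<close>.\<close>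
  ultimately have "translate (- v) q \<in> patches_covering \<T> x (norm_ball N R)"
    "translate w q \<in> patches_covering \<T> z (norm_ball N R)"
    by (metis (no_types, lifting) patches_covering_sub order_refl subset_trans translate_mono)+
  moreover have "translate (v + w) (translate (- v) q) = translate w q"
    by simp
  moreover have "v + w \<in> norm_ball N (r + s)"
    using is_norm_triangle[OF assms(1), of v w] x'(2) y2(2) by (simp add: norm_ball_def)
  ultimately show ?thesis
    unfolding close_tilings_def R_def by blast
qed

text \<open>Two small translates of a tile \<open>D \<in> x\<close> that both belong to \<open>y\<close> overlap, hence coincide;
  so arbitrarily small translations can occur only if the translation is trivial.\<close>

lemma subset_if_close_tilings:
  fixes N :: "real ^ 'n \<Rightarrow> real"
  assumes "is_norm N" "x \<in> full_tiling_space \<T>" "y \<in> full_tiling_space \<T>"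
    and close: "\<And>e. e > 0 \<Longrightarrow> \<exists>r. 0 < r \<and> r < e \<and> close_tilings N \<T> r x y"
  shows "x \<subseteq> y"
proof
  fix D assume D: "D \<in> x"
  have xy: "tiling x" "tiling y"
    using assms by (auto simp: full_tiling_space_def)
  have "tile D"
    using D xy tiling_tile by blast
  obtain p where p: "p \<in> interior D"
    using tile_interior_nonempty[OF \<open>tile D\<close>] by blast
  then obtain \<rho> where \<rho>: "\<rho> > 0" "ball p \<rho> \<subseteq> interior D"
    by (meson open_contains_ball open_interior)
  obtain c where c: "c > 0" "\<And>v. norm v \<le> c * N v"
    using norm_le_is_norm[OF assms(1)] by blast
  \<comment> \<open>The first bound makes \<open>v\<close> Euclidean-shorter than \<rho>, so that
    \<open>p\<close> stays interior to the moved tile. The second puts \<open>p\<close> inside the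
    ball of radius \<open>1 / r\<close>, so that \<open>D\<close> belongs to
    \<open>x'\<close>.\<close>
  define e0 where "e0 = min (\<rho> / c) (1 / (N p + 1))"
  have "N p \<ge> 0"
    by (rule is_norm_ge_0[OF assms(1)])
  then have e0: "e0 > 0" "c * e0 \<le> \<rho>"
    using c(1) \<rho>(1) by (auto simp: e0_def min_def field_simps)
  have small: "\<exists>v. N v < e \<and> p \<in> interior ((\<lambda>q. q - v) ` D) \<and> (\<lambda>q. q - v) ` D \<in> y"
    if e: "e > 0" "e \<le> e0" for e
  proof -
    obtain r where r: "0 < r" "r < e" "close_tilings N \<T> r x y"
      using close[OF e(1)] by blast
    then obtain x' v where x': "x' \<in> patches_covering \<T> x (norm_ball N (1 / r))" "N v \<le> r"
      and y': "translate v x' \<in> patches_covering \<T> y (norm_ball N (1 / r))"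
      by (auto simp: close_tilings_def norm_ball_def)
    have "r < 1 / (N p + 1)"
      using r e by (simp add: e0_def)
    then have "N p < 1 / r"
      using r(1) \<open>N p \<ge> 0\<close> by (simp add: field_simps)
    have "D \<in> x'"
    proof (rule tile_mem_if_meets_open_subset_supp[OF xy(1) _ open_is_norm_ball[OF assms(1)] _ D])
      show "x' \<subseteq> x" "{q. N (q - 0) < 1 / r} \<subseteq> supp x'"
        using x'(1) by (auto simp: patches_covering_def norm_ball_def)
      show "D \<inter> {q. N (q - 0) < 1 / r} \<noteq> {}"
        using p interior_subset \<open>N p < 1 / r\<close> by auto
    qed
    then have "(\<lambda>q. q - v) ` D \<in> y"
      using y' by (auto simp: patches_covering_def translate_def)
    moreover have "norm v < \<rho>"
    proof -
      have "c * N v < c * e0"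
        using c(1) x'(2) r e by simp
      then show ?thesis
        using c(2)[of v] e0(2) by simp
    qed
    then have "p + v \<in> interior D"
      using \<rho>(2) by (auto simp: subset_iff dist_norm)
    then have "p \<in> interior ((\<lambda>q. q - v) ` D)"
      unfolding interior_translation_subtract by (force simp: image_iff)
    ultimately show ?thesis
      using x'(2) r(2) by (intro exI[of _ v]) auto
  qed
  obtain v where v: "p \<in> interior ((\<lambda>q. q - v) ` D)" "(\<lambda>q. q - v) ` D \<in> y" "N v < e0"
    using small[of e0] e0(1) by auto
  show "D \<in> y"
  proof (cases "v = 0")
    case False
    then have "N v > 0"
      using is_norm_ge_0[OF assms(1), of v] is_norm_eq_0[OF assms(1), of v] by linarith
    \<comment> \<open>Scale \<open>N v\<close> yields a \<open>w\<close> strictly shorter than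
      \<open>v\<close>, whereas the overlap of the two moved tiles at \<open>p\<close> forces
      \<open>v = w\<close>.\<close>
    then obtain w where w: "p \<in> interior ((\<lambda>q. q - w) ` D)" "(\<lambda>q. q - w) ` D \<in> y" "N w < N v"
      using small[of "N v"] v(3) by auto
    have "(\<lambda>q. q - v) ` D = (\<lambda>q. q - w) ` D"
      using tiling_eqI[OF xy(2) v(2) w(2)] v(1) w(1) by blast
    then have "v = w"
      using \<open>tile D\<close> by (intro compact_translate_eqD[of D]) (auto simp: tile_def)
    then show ?thesis
      using w(3) by simp
  qed (use v in simp)
qed

lemma tiling_dist_nonneg: "0 \<le> tiling_dist N \<T> x y"
proof -
  have "\<not> 1 / sqrt 2 < (0 :: real)"
    by simp
  then have "\<not> tiling_dist N \<T> x y < 0"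
    unfolding tiling_dist_less_iff by auto
  then show ?thesis by simp
qed

lemma Metric_space_tiling_dist:
  fixes N :: "real ^ 'n \<Rightarrow> real"
  assumes "is_norm N" "finite \<T>" "\<T> \<subseteq> prototiles"
  shows "Metric_space (full_tiling_space \<T>) (tiling_dist N \<T>)"
proof
  let ?d = "tiling_dist N \<T>"
  show "0 \<le> ?d x y" for x y
    by (rule tiling_dist_nonneg)
  show "?d x y = ?d y x" for x y
  proof -
    have "close_tilings N \<T> r x y \<longleftrightarrow> close_tilings N \<T> r y x" for r
      using close_tilings_sym[OF assms(1)] by blast
    then have "?d x y < e \<longleftrightarrow> ?d y x < e" for e
      by (simp add: tiling_dist_less_iff)
    \<comment> \<open>Two reals with the same strict upper bounds are equal.\<close>
    then show ?thesis
      by (metis linorder_neq_iff order_less_irrefl)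
  qed
  show "?d x y = 0 \<longleftrightarrow> x = y" if xy: "x \<in> full_tiling_space \<T>" "y \<in> full_tiling_space \<T>" for x y
  proof
    assume "?d x y = 0"
    have close: "\<exists>r. 0 < r \<and> r < e \<and> close_tilings N \<T> r x y" if "e > 0" for e
    proof -
      \<comment> \<open>The minimum with the cap rules out the first disjunct of
        \<open>tiling_dist_less_iff\<close>.\<close>
      have "?d x y < min e (1 / sqrt 2)"
        using \<open>?d x y = 0\<close> that by simp
      then show ?thesis
        unfolding tiling_dist_less_iff by auto
    qed
    show "x = y"
      using subset_if_close_tilings[OF assms(1)] close close_tilings_sym[OF assms(1)] xy
      by (metis subset_antisym)
  next
    assume "x = y"
    show "?d x y = 0"
    proof (rule ccontr)
      assume "?d x y \<noteq> 0"
      then have pos: "?d x y > 0"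
        using tiling_dist_nonneg[of N \<T> x y] by simp
      \<comment> \<open>A scale below both the cap and the supposedly positive distance; reflexivity
        at this scale gives \<open>?d x y < ?d x y\<close>.\<close>
      define r where "r = min (?d x y) (1 / sqrt 2) / 2"
      have r: "0 < r" "r < 1 / sqrt 2" "r < ?d x y"
        using pos by (auto simp: r_def min_def field_simps)
      then have "?d x y < ?d x y"
        using close_tilings_refl[OF assms xy(1) r(1)] \<open>x = y\<close> tiling_dist_less_iff by blast
      then show False by simp
    qed
  qed
  show "?d x z \<le> ?d x y + ?d y z"
    if "x \<in> full_tiling_space \<T>" "y \<in> full_tiling_space \<T>" "z \<in> full_tiling_space \<T>" for x y z
  proof (rule field_le_epsilon)
    fix e :: real assume "e > 0"
    \<comment> \<open>The slack \<open>e / 2\<close> turns both distances into strict bounds, which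
      supply scales when the cap is not reached.\<close>
    define a where "a = ?d x y + e / 2"
    define b where "b = ?d y z + e / 2"
    have ab: "?d x y < a" "?d y z < b" "0 < a" "0 < b"
      using \<open>e > 0\<close> tiling_dist_nonneg[of N \<T> x y] tiling_dist_nonneg[of N \<T> y z]
      by (auto simp: a_def b_def)
    have "?d x z \<le> a + b"
    proof (cases "1 / sqrt 2 \<le> a + b")
      case True
      moreover have "?d x z \<le> 1 / sqrt 2"
        using ereal_tiling_dist[of N \<T> x z] by (metis ereal_less_eq(3) min.cobounded1)
      ultimately show ?thesis by simp
    next
      case False
      then have "\<not> 1 / sqrt 2 < a" "\<not> 1 / sqrt 2 < b"
        using ab by auto
      then obtain r s where r: "0 < r" "r < a" "close_tilings N \<T> r x y"
        and s: "0 < s" "s < b" "close_tilings N \<T> s y z"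
        using ab(1,2) unfolding tiling_dist_less_iff by auto
      \<comment> \<open>Below the cap the scales add up to less than 1, as
        \<open>close_tilings_trans\<close> requires.\<close>
      have "1 / sqrt 2 < (1 :: real)"
        by simp
      then have "r + s < 1"
        using False r(2) s(2) by linarith
      then have "close_tilings N \<T> (r + s) x z"
        using r s that assms by (intro close_tilings_trans[where y = y]) auto
      then have "?d x z < a + b"
        unfolding tiling_dist_less_iff using r s False by (intro disjI2 exI[of _ "r + s"]) auto
      then show ?thesis by simp
    qed
    then show "?d x z \<le> ?d x y + ?d y z + e"
      by (simp add: a_def b_def)
  qed
qed

subsection \<open>Continuity of the action\<close>

text \<open>The vector \<open>w + v' - v\<close> relates the two translated patches, and the first
  condition on \<open>s\<close> bounds its length. The other two let each patch still cover the ball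
  of radius \<open>1 / s\<close> after its own shift.\<close>

lemma close_tilings_translate:
  fixes N :: "real ^ 'n \<Rightarrow> real"
  assumes "is_norm N" "\<T> \<subseteq> prototiles" "close_tilings N \<T> r x y"
    and s: "r + N (v' - v) \<le> s" "1 / s + N v \<le> 1 / r" "1 / s + N v' \<le> 1 / r"
  shows "close_tilings N \<T> s (translate v x) (translate v' y)"
proof -
  obtain x' w where x': "x' \<in> patches_covering \<T> x (norm_ball N (1 / r))" "N w \<le> r"
    and y': "translate w x' \<in> patches_covering \<T> y (norm_ball N (1 / r))"
    using assms(3) by (auto simp: close_tilings_def norm_ball_def)
  have shift: "p + u \<in> norm_ball N (1 / r)"
    if "p \<in> norm_ball N (1 / s)" "1 / s + N u \<le> 1 / r" for p u
    using that is_norm_triangle[OF assms(1), of p u] by (simp add: norm_ball_def)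
  have "translate v x' \<in> patches_covering \<T> (translate v x) (norm_ball N (1 / s))"
    "translate v' (translate w x') \<in> patches_covering \<T> (translate v' y) (norm_ball N (1 / s))"
    using patches_covering_translate[OF assms(2)] x' y' shift s by blast+
  moreover have "translate (w + v' - v) (translate v x') = translate v' (translate w x')"
    by simp
  moreover have "w + v' - v \<in> norm_ball N s"
    using is_norm_triangle[OF assms(1), of w "v' - v"] x'(2) s(1)
    by (simp add: norm_ball_def algebra_simps)
  ultimately show ?thesis
    unfolding close_tilings_def by metis
qed

theorem proposition5p5:
  fixes N :: "real ^ 'n \<Rightarrow> real"
    and \<T> :: "(real ^ 'n) set set set"
  assumes "is_norm N"
    and "finite \<T>"
    and "\<T> \<subseteq> prototiles"
  shows "continuous_map (prod_topology euclidean (tiling_topology N \<T>)) (tiling_topology N \<T>)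
           (\<lambda>(v, x). translate v x)"
proof -
  interpret X: Metric_space "full_tiling_space \<T>" "tiling_dist N \<T>"
    by (rule Metric_space_tiling_dist[OF assms])
  have "\<exists>U. openin (prod_topology euclidean X.mtopology) U \<and> (v, x) \<in> U \<and>
      (\<forall>(v', y)\<in>U. translate v' y \<in> X.mball (translate v x) \<epsilon>)"
    if x: "x \<in> full_tiling_space \<T>" and "\<epsilon> > 0" for v x \<epsilon>
  proof -
    \<comment> \<open>The target scale; halving places it strictly below \<epsilon> and the
      cap.\<close>
    define s where "s = min \<epsilon> (1 / sqrt 2) / 2"
    have s: "0 < s" "s < \<epsilon>" "s < 1 / sqrt 2"
      using \<open>\<epsilon> > 0\<close> by (auto simp: s_def min_def field_simps)
    have pos: "1 / s + N v + 1 > 0"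
      using s(1) is_norm_ge_0[OF assms(1), of v] by (simp add: add_pos_nonneg)
    \<comment> \<open>The term \<open>s / 2\<close> gives \<open>r + N (v' - v) \<le> s\<close>, the
      term 1 gives \<open>N v' \<le> N v + 1\<close>, and the last one gives
      \<open>1 / s + N v + 1 \<le> 1 / r\<close>, enough for both shifts.\<close>
    define \<delta> where "\<delta> = min (s / 2) (min 1 (1 / (1 / s + N v + 1)))"
    have \<delta>: "0 < \<delta>" "2 * \<delta> \<le> s" "\<delta> \<le> 1" "\<delta> \<le> 1 / (1 / s + N v + 1)"
      using s(1) pos by (auto simp: \<delta>_def)
    let ?U = "{v'. N (v' - v) < \<delta>} \<times> X.mball x \<delta>"
    have "translate v' y \<in> X.mball (translate v x) \<epsilon>"
      if v': "N (v' - v) < \<delta>" and y: "y \<in> X.mball x \<delta>" for v' y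
    proof -
      \<comment> \<open>Since \<delta> does not exceed the cap, membership in the ball about
        \<open>x\<close> provides an actual scale \<open>r\<close>.\<close>
      have "\<not> 1 / sqrt 2 < \<delta>"
        using \<delta> s by linarith
      then obtain r where r: "0 < r" "r < \<delta>" "close_tilings N \<T> r x y"
        using y by (auto simp: tiling_dist_less_iff)
      have "r * (1 / s + N v + 1) \<le> \<delta> * (1 / s + N v + 1)"
        using r pos by (intro mult_right_mono) auto
      also have "\<dots> \<le> 1"
        using \<delta>(4) pos by (simp add: pos_le_divide_eq)
      finally have "1 / s + N v + 1 \<le> 1 / r"
        using r(1) by (simp add: pos_le_divide_eq mult.commute)
      moreover have "N v' \<le> N v + 1"
        using is_norm_triangle[OF assms(1), of "v' - v" v] v' \<delta>(3) by simp
      ultimately have "close_tilings N \<T> s (translate v x) (translate v' y)"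
        using r v' \<delta>(2) by (intro close_tilings_translate[OF assms(1,3) r(3)]) auto
      then have "tiling_dist N \<T> (translate v x) (translate v' y) < \<epsilon>"
        using s tiling_dist_less_iff by blast
      then show ?thesis
        using x y full_tiling_space_translate[OF assms(3)] by simp
    qed
    moreover have "openin (prod_topology euclidean X.mtopology) ?U"
      using open_is_norm_ball[OF assms(1)] by (simp add: openin_prod_Times_iff)
    moreover have "(v, x) \<in> ?U"
      using x \<delta>(1) by (simp add: is_norm_0[OF assms(1)])
    ultimately show ?thesis
      by (intro exI[of _ ?U]) auto
  qed
  then show ?thesis
    unfolding tiling_topology_def X.continuous_map_to_metric
    by (fastforce simp: split_beta)
qed

end
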